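(* For every integer $n\ge 0$ and every real $x>0$, $$\gamma_n(x) = -\frac{\log^{n+1} x}{n+1} + \sum_{k=0}^{\infty}\left[\frac{\log^n(k+x)}{k+x} - \frac{1}{n+1}\left[\log^{n+1}(k+1+x) - \log^{n+1}(k+x)\right]\right],$$ and $$\gamma_n = \sum_{k=1}^{\infty}\left[\frac{\log^n k}{k} - \frac{1}{n+1}\left[\log^{n+1}(k+1) - \log^{n+1} k\right]\right].$$
   Context: For $x>0$ the Hurwitz zeta function is $\varsigma(s,x)=\sum_{m=0}^{\infty}\frac{1}{(m+x)^s}$ for $\operatorname{Re} s>1$, analytically continued in $s$ to the whole complex plane except for a simple pole at $s=1$. The generalised Stieltjes constants $\gamma_n(x)$ ($n\ge 0$) are defined by the Laurent expansion about $s=1$ $$\varsigma(s,x)=\frac{1}{s-1}+\sum_{n=0}^{\infty}\frac{(-1)^n}{n!}\gamma_n(x)(s-1)^n .$$ The Stieltjes constants are $\gamma_n=\gamma_n(1)$, i.e. the corresponding coefficients for the Riemann zeta function $\varsigma(s)=\varsigma(s,1)$. The notation $\log^m y$ means $(\log y)^m$ with the natural logarithm, and $\log^0 y=1$ for all $y>0$ (including $y=1$). Infinite series are understood as limits of their partial sums. *)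

theory Defs
  imports "HOL-Complex_Analysis.Complex_Analysis"
begin

text \<open>
  The Hurwitz zeta function with parameter \<open>x > 0\<close> as the analytic continuation of its Dirichlet
  series to the punctured plane. The value \<open>0\<close> at the pole \<open>s = 1\<close> is a convention which only
  serves to make the description unique.
\<close>
definition hurwitz_zeta :: "complex \<Rightarrow> real \<Rightarrow> complex" where
  "hurwitz_zeta s x =
     (THE f. f holomorphic_on (- {1}) \<and> f 1 = 0 \<and>
        (\<forall>z. Re z > 1 \<longrightarrow> (\<lambda>m. 1 / complex_of_real (real m + x) powr z) sums f z)) s"

text \<open>
  The whole sequence of generalised Stieltjes constants is described at once, by the Laurent
  expansion in a punctured neighbourhood of \<open>s = 1\<close>. The constants are complex numbers by
  definition; that they are real is not presupposed.
\<close>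
definition gen_stieltjes :: "nat \<Rightarrow> real \<Rightarrow> complex" where
  "gen_stieltjes n x =
     (THE c. \<forall>\<^sub>F s in at 1.
        (\<lambda>k. (-1) ^ k / fact k * c k * (s - 1) ^ k) sums (hurwitz_zeta s x - 1 / (s - 1))) n"

definition stieltjes :: "nat \<Rightarrow> complex" where
  "stieltjes n = gen_stieltjes n 1"

end

theory Submission
  imports Defs
begin

text \<open>
  Write \<open>y = m + x\<close>. Comparing the term \<open>y powr -s\<close> of the Dirichlet series with its integral over
  the cell \<open>[y, y + 1]\<close> leaves the error
  \<open>h m s = y powr -s - (y powr (1 - s) - (y + 1) powr (1 - s)) / (s - 1)\<close>. The subtracted quotients
  telescope to \<open>x powr (1 - s) / (s - 1)\<close>, and integration by parts gives
  \<open>h m s = s * (\<integral>t\<in>[0,1]. (1 - t) * (y + t) powr (- s - 1))\<close>, which is \<open>O(m powr (- Re s - 1))\<close>.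
  Hence for \<open>Re s > 0\<close> and \<open>s \<noteq> 1\<close>
  \<open>hurwitz_zeta s x - 1 / (s - 1) = (x powr (1 - s) - 1) / (s - 1) + (\<Sum>m. h m s)\<close>,
  with a series of entire functions that converges uniformly near \<open>s = 1\<close>. By Weierstrass' theorem
  its Taylor coefficients at \<open>1\<close> are the sums of those of the \<open>h m\<close>, and expanding the exponentials
  \<open>exp (- (s - 1) * ln y)\<close> shows that the latter, multiplied by \<open>(-1) ^ n * n!\<close>, are the terms of
  the asserted series, while in the same normalisation the first quotient contributes \<open>- (ln x) ^ (n + 1) / (n + 1)\<close>
  (lemmas \<open>higher_deriv_shifted_cell\<close>, \<open>stieltjes_term_sums\<close> and \<open>gen_stieltjes_eq\<close>).

  The Hurwitz zeta function is specified by a definite description over functions holomorphic on the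
  whole punctured plane, so the argument also needs the full continuation to exist. For continuous
  \<open>p\<close> on \<open>[0,1]\<close>, extended periodically from the point \<open>x\<close>, put
  \<open>P(s) = \<integral>u\<ge>x. p(u) * u powr -s\<close>, the sum over \<open>m\<close> of the integrals over the cells
  \<open>[m + x, m + 1 + x]\<close>. If \<open>c\<close> is the mean of \<open>p\<close>, then the primitive \<open>q\<close> of \<open>p - c\<close> vanishing at
  \<open>0\<close> vanishes at \<open>1\<close> as well, hence is again periodic, and integration by parts expresses \<open>P(s)\<close>
  by \<open>c * x powr (1 - s) / (s - 1)\<close> and the transform of \<open>q\<close> at \<open>s + 1\<close>. Each such step moves the
  domain of \<open>(s - 1) * P(s)\<close> one unit to the left; the sawtooth \<open>p(t) = 1 - t\<close> is the case that
  occurs in the zeta function.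
\<close>

section \<open>Mellin transforms of periodic functions\<close>

text \<open>
  The index is the number of the cell, so that the sum over all cells is the integral over
  \<open>[x, \<infinity>)\<close> of the periodic extension of \<open>p\<close> against \<open>u powr -s\<close>.
\<close>
definition cell_integral :: "(real \<Rightarrow> complex) \<Rightarrow> real \<Rightarrow> nat \<Rightarrow> complex \<Rightarrow> complex" where
  "cell_integral p x m s =
     integral {0..1} (\<lambda>t. p t * complex_of_real (real m + x + t) powr (- s))"

definition periodic_mellin :: "(real \<Rightarrow> complex) \<Rightarrow> real \<Rightarrow> complex \<Rightarrow> complex" where
  "periodic_mellin p x s = (\<Sum>m. cell_integral p x m s)"

lemma cell_integrand_continuous:
  assumes "x > 0" "continuous_on {0..1} p"
  shows "continuous_on {0..1} (\<lambda>t. p t * complex_of_real (real m + x + t) powr (- s))"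
proof -
  have "real m + x + t > 0" if "t \<in> {0..1}" for t
    using that assms by auto
  then have "complex_of_real (real m + x + t) \<noteq> 0" "Re (complex_of_real (real m + x + t)) \<ge> 0"
    if "t \<in> {0..1}" for t
    using that unfolding of_real_eq_0_iff Re_complex_of_real by fastforce+
  then show ?thesis
    by (intro continuous_on_mult assms continuous_on_powr_complex continuous_intros) blast+
qed

lemma cell_integral_holomorphic:
  assumes "x > 0" and p: "continuous_on {0..1} p"
  shows "cell_integral p x m holomorphic_on A"
proof -
  let ?y = "\<lambda>t. complex_of_real (real m + x + t)"
  have y: "?y t \<notin> \<real>\<^sub>\<le>\<^sub>0" "?y t \<noteq> 0" if "t \<in> {0..1}" for t
    using that \<open>x > 0\<close> unfolding of_real_eq_0_iff complex_nonpos_Reals_iff by auto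
  have "(\<lambda>s. integral (cbox 0 1) (\<lambda>t. p t * ?y t powr (- s))) holomorphic_on UNIV"
  proof (rule leibniz_rule_holomorphic[where fx = "\<lambda>s t. - (p t * (Ln (?y t) * ?y t powr (- s)))"])
    show "((\<lambda>s. p t * ?y t powr (- s)) has_field_derivative - (p t * (Ln (?y t) * ?y t powr (- s))))
        (at s within UNIV)" if "t \<in> cbox 0 1" for s t
    proof -
      have "((\<lambda>s. ?y t powr (- s)) has_field_derivative Ln (?y t) * ?y t powr (- s) * (- 1)) (at s)"
        by (rule DERIV_chain2[OF has_field_derivative_powr_right])
          (use y(2)[of t] that in \<open>auto intro!: derivative_eq_intros simp del: of_real_add\<close>)
      from DERIV_cmult[OF this, of "p t"] show ?thesis
        by simp
    qed
    show "(\<lambda>t. p t * ?y t powr (- s)) integrable_on cbox 0 1" for s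
      unfolding cbox_interval
      by (intro integrable_continuous_interval cell_integrand_continuous assms)
    have p': "continuous_on (UNIV \<times> cbox 0 1) (\<lambda>z :: complex \<times> real. p (snd z))"
      by (intro continuous_on_compose2[OF p] continuous_intros) auto
    have y': "?y (snd z) \<notin> \<real>\<^sub>\<le>\<^sub>0" "?y (snd z) \<noteq> 0" "Re (?y (snd z)) \<ge> 0"
      if "z \<in> UNIV \<times> cbox 0 1" for z :: "complex \<times> real"
      using y[of "snd z"] that \<open>x > 0\<close> by (auto simp del: of_real_add)
    show "continuous_on (UNIV \<times> cbox 0 1) (\<lambda>(s, t). - (p t * (Ln (?y t) * ?y t powr (- s))))"
      unfolding case_prod_unfold
      by (intro continuous_on_minus continuous_on_mult p' continuous_on_Ln
          continuous_on_powr_complex continuous_intros) (use y' in blast)+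
  qed auto
  then show ?thesis
    unfolding cell_integral_def[abs_def] cbox_interval
    using holomorphic_on_subset by blast
qed

lemma norm_cell_integral_le:
  assumes "x > 0" and p: "continuous_on {0..1} p"
    and B: "\<And>t. t \<in> {0..1} \<Longrightarrow> norm (p t) \<le> B" and s: "Re s \<ge> 0"
  shows "norm (cell_integral p x m s) \<le> B * (real m + x) powr (- Re s)"
proof -
  have "norm (integral {0..1} (\<lambda>t. p t * complex_of_real (real m + x + t) powr (- s)))
      \<le> B * (real m + x) powr (- Re s) * (1 - 0)"
  proof (rule integral_bound)
    fix t :: real assume t: "t \<in> {0..1}"
    have "norm (complex_of_real (real m + x + t) powr (- s)) = (real m + x + t) powr (- Re s)"
      using t \<open>x > 0\<close> by (subst norm_powr_real_powr) auto
    also have "\<dots> \<le> (real m + x) powr (- Re s)"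
      using t \<open>x > 0\<close> s by (intro powr_mono2') auto
    finally show "norm (p t * complex_of_real (real m + x + t) powr (- s))
        \<le> B * (real m + x) powr (- Re s)"
      unfolding norm_mult using B[OF t] order_trans[OF norm_ge_zero B[OF t]]
      by (intro mult_mono) (auto simp del: of_real_add)
  qed (use cell_integrand_continuous[OF assms(1,2)] in auto)
  then show ?thesis
    by (simp add: cell_integral_def)
qed

text \<open>
  The bound \<open>(m + x) powr - Re s \<le> (m + x) powr -\<sigma>\<close> fails in the cell \<open>m = 0\<close> when \<open>x < 1\<close>,
  because \<open>x powr - Re s\<close> then grows with \<open>Re s\<close>. The M-test is therefore applied from \<open>m = 1\<close> on.
\<close>
lemma periodic_mellin_uniform_limit:
  assumes "x > 0" and p: "continuous_on {0..1} p" and "\<sigma> > 1"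
  shows "uniform_limit {s. Re s \<ge> \<sigma>} (\<lambda>N s. \<Sum>m<N. cell_integral p x m s) (periodic_mellin p x)
    sequentially"
proof -
  have "bounded (p ` {0..1})"
    using p by (intro compact_imp_bounded compact_continuous_image) auto
  then obtain B where B: "\<And>t. t \<in> {0..1} \<Longrightarrow> norm (p t) \<le> B"
    unfolding bounded_iff by blast
  have "B \<ge> 0"
    using order_trans[OF norm_ge_zero B[of 0]] by simp
  show ?thesis
    unfolding periodic_mellin_def[abs_def]
  proof (rule Weierstrass_m_test_ev)
    show "summable (\<lambda>m. B * real m powr (- \<sigma>))"
      using \<open>\<sigma> > 1\<close> by (intro summable_mult) (simp add: summable_real_powr_iff)
    show "\<forall>\<^sub>F m in sequentially. \<forall>s\<in>{s. Re s \<ge> \<sigma>}.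
        norm (cell_integral p x m s) \<le> B * real m powr (- \<sigma>)"
      using eventually_ge_at_top[of 1]
    proof (eventually_elim, intro ballI)
      fix m :: nat and s assume m: "m \<ge> 1" and s: "s \<in> {s. Re s \<ge> \<sigma>}"
      have "norm (cell_integral p x m s) \<le> B * (real m + x) powr (- Re s)"
        using s \<open>\<sigma> > 1\<close> by (intro norm_cell_integral_le assms B) auto
      also have "(real m + x) powr (- Re s) \<le> (real m + x) powr (- \<sigma>)"
        using s m \<open>x > 0\<close> by (intro powr_mono) auto
      also have "\<dots> \<le> real m powr (- \<sigma>)"
        using m \<open>x > 0\<close> \<open>\<sigma> > 1\<close> by (intro powr_mono2') auto
      finally show "norm (cell_integral p x m s) \<le> B * real m powr (- \<sigma>)"
        using \<open>B \<ge> 0\<close> by (simp add: mult_left_mono)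
    qed
  qed
qed

lemma cell_integral_sums:
  assumes "x > 0" "continuous_on {0..1} p" "Re s > 1"
  shows "(\<lambda>m. cell_integral p x m s) sums periodic_mellin p x s"
  unfolding sums_def
  using periodic_mellin_uniform_limit[OF assms(1,2,3)] by (rule tendsto_uniform_limitI) simp

lemma periodic_mellin_holomorphic:
  assumes "x > 0" "continuous_on {0..1} p"
  shows "periodic_mellin p x holomorphic_on {s. Re s > 1}"
proof (rule holomorphic_uniform_sequence)
  show "open {s. Re s > 1}"
    by (rule open_halfspace_Re_gt)
  show "(\<lambda>s. \<Sum>m<N. cell_integral p x m s) holomorphic_on {s. Re s > 1}" for N
    by (intro holomorphic_intros cell_integral_holomorphic assms)
  fix z assume z: "z \<in> {s. Re s > 1}"
  define d where "d = (Re z - 1) / 2"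
  have d: "d > 0" "1 + d > 1"
    using z by (auto simp: d_def)
  have sub: "cball z d \<subseteq> {s. Re s \<ge> 1 + d}"
  proof
    fix s assume "s \<in> cball z d"
    then have "Re z - Re s \<le> d"
      using complex_Re_le_cmod[of "z - s"] by (simp add: dist_norm)
    then have "Re s \<ge> 1 + d"
      unfolding d_def by argo
    then show "s \<in> {s. Re s \<ge> 1 + d}"
      by simp
  qed
  have "uniform_limit (cball z d) (\<lambda>N s. \<Sum>m<N. cell_integral p x m s) (periodic_mellin p x)
      sequentially"
    using uniform_limit_on_subset[OF periodic_mellin_uniform_limit[OF assms d(2)] sub] .
  moreover have "cball z d \<subseteq> {s. Re s > 1}"
    using sub d by auto
  ultimately show "\<exists>d>0. cball z d \<subseteq> {s. Re s > 1} \<and>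
      uniform_limit (cball z d) (\<lambda>N s. \<Sum>m<N. cell_integral p x m s) (periodic_mellin p x)
        sequentially"
    using d by blast
qed

text \<open>
  Integration by parts with a primitive \<open>q\<close> of \<open>p - c\<close>, the constant \<open>c\<close> being integrated exactly.
  The boundary values of \<open>q\<close> are kept: the continuation uses \<open>q\<close> vanishing at both ends, whereas
  the zeta function arises from \<open>p = 0\<close>, \<open>c = 1\<close> and \<open>q t = 1 - t\<close>, where the boundary term
  at \<open>0\<close> is the term of the Dirichlet series.
\<close>
lemma cell_integral_by_parts:
  fixes q :: "real \<Rightarrow> complex"
  assumes "x > 0" and p: "continuous_on {0..1} p"
    and q: "\<And>t. t \<in> {0..1} \<Longrightarrow> (q has_vector_derivative p t - c) (at t within {0..1})"
    and "s \<noteq> 1"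
  shows "cell_integral p x m s =
      q 1 * complex_of_real (real m + 1 + x) powr (- s) - q 0 * complex_of_real (real m + x) powr (- s)
    + c / (s - 1) * (complex_of_real (real m + x) powr (1 - s)
                     - complex_of_real (real m + 1 + x) powr (1 - s))
    + s * cell_integral q x m (s + 1)"
proof -
  let ?y = "\<lambda>t. complex_of_real (real m + x + t)"
  \<comment> \<open>A primitive, in \<open>t\<close>, of the difference of the two cell integrands.\<close>
  define \<Psi> where "\<Psi> = (\<lambda>t. q t * ?y t powr (- s) - c / (s - 1) * ?y t powr (1 - s))"
  have contq: "continuous_on {0..1} q"
    by (rule continuous_on_vector_derivative[OF q])
  have y: "?y t \<notin> \<real>\<^sub>\<le>\<^sub>0" if "t \<in> {0..1}" for t
    using that \<open>x > 0\<close> unfolding complex_nonpos_Reals_iff by auto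
  have D: "((\<lambda>t. ?y t powr a) has_vector_derivative a * ?y t powr (a - 1)) (at t within {0..1})"
    if "t \<in> {0..1}" for a t
  proof -
    have "((\<lambda>t. complex_of_real (real m + x) + of_real t) has_vector_derivative 1) (at t within {0..1})"
      by (auto intro!: derivative_eq_intros)
    then have "(?y has_vector_derivative 1) (at t within {0..1})"
      by simp
    from field_vector_diff_chain_within[OF this, of "\<lambda>z. z powr a" "a * ?y t powr (a - 1)"]
    show ?thesis
      using has_field_derivative_powr[OF y[OF that], of a]
      by (auto simp: o_def has_field_derivative_at_within)
  qed
  have "((\<lambda>t. p t * ?y t powr (- s) - s * (q t * ?y t powr (- (s + 1)))) has_integral (\<Psi> 1 - \<Psi> 0)) {0..1}"
  proof (rule fundamental_theorem_of_calculus)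
    fix t :: real assume t: "t \<in> {0..1}"
    have "(\<Psi> has_vector_derivative
        (q t * (- s * ?y t powr (- s - 1)) + (p t - c) * ?y t powr (- s))
          - c / (s - 1) * ((1 - s) * ?y t powr (1 - s - 1))) (at t within {0..1})"
      unfolding \<Psi>_def
      by (intro has_vector_derivative_diff has_vector_derivative_mult q D t
          has_vector_derivative_mult_right)
    moreover have ex: "- s - 1 = - (s + 1)" "1 - s - 1 = - s"
      by simp_all
    moreover have "q t * (- s * Z) + (p t - c) * Y - c / (s - 1) * ((1 - s) * Y) = p t * Y - s * (q t * Z)"
      for Y Z
      using \<open>s \<noteq> 1\<close> by (simp add: field_simps)
    ultimately show "(\<Psi> has_vector_derivative
        p t * ?y t powr (- s) - s * (q t * ?y t powr (- (s + 1)))) (at t within {0..1})"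
      by (simp only: ex)
  qed simp
  moreover have "((\<lambda>t. p t * ?y t powr (- s) - s * (q t * ?y t powr (- (s + 1)))) has_integral
      (cell_integral p x m s - s * cell_integral q x m (s + 1))) {0..1}"
    unfolding cell_integral_def
    by (intro has_integral_diff has_integral_mult_right integrable_integral
        integrable_continuous_interval cell_integrand_continuous \<open>x > 0\<close> p contq)
  ultimately have "cell_integral p x m s - s * cell_integral q x m (s + 1) = \<Psi> 1 - \<Psi> 0"
    by (rule has_integral_unique[rotated])
  then show ?thesis
    by (simp add: \<Psi>_def algebra_simps)
qed

lemma telescoping_powr_sums:
  assumes "x > 0" "Re s > 1"
  shows "(\<lambda>m. complex_of_real (real m + x) powr (1 - s)
            - complex_of_real (real m + 1 + x) powr (1 - s)) sums (complex_of_real x powr (1 - s))"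
proof -
  have "filterlim (\<lambda>m. x + real m) at_top sequentially"
    by (intro filterlim_tendsto_add_at_top[OF tendsto_const] filterlim_real_sequentially)
  then have "(\<lambda>m. complex_of_real (x + real m) powr (1 - s)) \<longlonglongrightarrow> 0"
    using assms by (intro tendsto_neg_powr_complex_of_real) auto
  from telescope_sums'[OF this] show ?thesis
    by (simp add: algebra_simps)
qed

lemma periodic_mellin_by_parts:
  fixes q :: "real \<Rightarrow> complex"
  assumes "x > 0" and p: "continuous_on {0..1} p"
    and q: "\<And>t. t \<in> {0..1} \<Longrightarrow> (q has_vector_derivative p t - c) (at t within {0..1})"
    and q01: "q 0 = 0" "q 1 = 0" and s: "Re s > 1"
  shows "periodic_mellin p x s =
      c / (s - 1) * complex_of_real x powr (1 - s) + s * periodic_mellin q x (s + 1)"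
proof -
  have "s \<noteq> 1"
    using s by auto
  have contq: "continuous_on {0..1} q"
    by (rule continuous_on_vector_derivative[OF q])
  have "(\<lambda>m. c / (s - 1) * (complex_of_real (real m + x) powr (1 - s)
                     - complex_of_real (real m + 1 + x) powr (1 - s))
            + s * cell_integral q x m (s + 1))
        sums (c / (s - 1) * complex_of_real x powr (1 - s) + s * periodic_mellin q x (s + 1))"
    using s by (intro sums_add sums_mult telescoping_powr_sums cell_integral_sums contq \<open>x > 0\<close>) auto
  moreover have "cell_integral p x m s = c / (s - 1) * (complex_of_real (real m + x) powr (1 - s)
                     - complex_of_real (real m + 1 + x) powr (1 - s))
            + s * cell_integral q x m (s + 1)" for m
    using cell_integral_by_parts[OF \<open>x > 0\<close> p q \<open>s \<noteq> 1\<close>, of m] q01 by simp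
  ultimately have "(\<lambda>m. cell_integral p x m s) sums
      (c / (s - 1) * complex_of_real x powr (1 - s) + s * periodic_mellin q x (s + 1))"
    by simp
  with cell_integral_sums[OF \<open>x > 0\<close> p s] show ?thesis
    by (rule sums_unique2)
qed

section \<open>Analytic continuation of the Hurwitz zeta function\<close>

text \<open>
  Induction over the number of integrations by parts. The statement is for all \<open>p\<close> at once because
  \<open>p\<close> is replaced by the primitive of \<open>p\<close> minus its mean. The factor \<open>s - 1\<close> removes the pole of
  the boundary term, and for the transform of \<open>q\<close> at \<open>s + 1\<close> this factor is \<open>s\<close>, which is what the
  integration by parts supplies.
\<close>
lemma periodic_mellin_continues_to_halfplane:
  assumes "x > 0"
  shows "continuous_on {0..1} p \<Longrightarrow> \<exists>E. E holomorphic_on {s. Re s > 1 - real K} \<and>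
           (\<forall>s. Re s > 1 \<longrightarrow> E s = (s - 1) * periodic_mellin p x s)"
proof (induction K arbitrary: p)
  case 0
  then show ?case
    using periodic_mellin_holomorphic[OF \<open>x > 0\<close> 0]
    by (intro exI[of _ "\<lambda>s. (s - 1) * periodic_mellin p x s"])
      (auto intro!: holomorphic_intros)
next
  case (Suc K)
  define c where "c = integral {0..1} p"
  define q where "q = (\<lambda>t. integral {0..t} (\<lambda>u. p u - c))"
  have pc: "continuous_on {0..1} (\<lambda>u. p u - c)"
    by (intro continuous_intros Suc.prems)
  have q: "(q has_vector_derivative p t - c) (at t within {0..1})" if "t \<in> {0..1}" for t
    unfolding q_def by (rule integral_has_vector_derivative[OF pc that])
  have q01: "q 0 = 0" "q 1 = 0"
    unfolding q_def c_def
    by (simp_all add: integral_diff integrable_continuous_interval Suc.prems)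
  have "continuous_on {0..1} q"
    by (rule continuous_on_vector_derivative[OF q])
  from Suc.IH[OF this] obtain E where E: "E holomorphic_on {s. Re s > 1 - real K}"
    "\<And>s. Re s > 1 \<Longrightarrow> E s = (s - 1) * periodic_mellin q x s"
    by blast
  define E' where "E' = (\<lambda>s. c * complex_of_real x powr (1 - s) + (s - 1) * E (s + 1))"
  have "(E \<circ> (\<lambda>s. s + 1)) holomorphic_on {s. Re s > 1 - real (Suc K)}"
    by (rule holomorphic_on_compose_gen[OF _ E(1)]) (auto intro!: holomorphic_intros)
  then have "E' holomorphic_on {s. Re s > 1 - real (Suc K)}"
    unfolding E'_def by (intro holomorphic_intros) (simp_all add: o_def)
  moreover have "E' s = (s - 1) * periodic_mellin p x s" if "Re s > 1" for s
  proof -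
    have "s \<noteq> 1"
      using that by auto
    have "E' s = c * complex_of_real x powr (1 - s) + (s - 1) * (s * periodic_mellin q x (s + 1))"
      using that by (simp add: E'_def E(2))
    also have "\<dots> = (s - 1) * (c / (s - 1) * complex_of_real x powr (1 - s)
        + s * periodic_mellin q x (s + 1))"
      using \<open>s \<noteq> 1\<close> unfolding distrib_left by simp
    also have "\<dots> = (s - 1) * periodic_mellin p x s"
      using periodic_mellin_by_parts[OF \<open>x > 0\<close> Suc.prems q q01 that] by simp
    finally show ?thesis .
  qed
  ultimately show ?case
    by blast
qed

text \<open>
  By the identity theorem the extensions agree wherever they overlap, so at each point the value of
  any of them may be taken.
\<close>
lemma entire_continuation_from_halfplanes:
  assumes ext: "\<And>K. \<exists>E. E holomorphic_on {s. Re s > a - real K} \<and> (\<forall>s. Re s > a \<longrightarrow> E s = f s)"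
  obtains E where "E holomorphic_on UNIV" "\<And>s. Re s > a \<Longrightarrow> E s = f s"
proof -
  define U where "U = (\<lambda>K. {s. Re s > a - real K})"
  have U: "open (U K)" "connected (U K)" for K
    unfolding U_def by (simp_all add: open_halfspace_Re_gt convex_halfspace_Re_gt convex_connected)
  obtain G where G: "\<And>K. G K holomorphic_on U K" "\<And>K s. Re s > a \<Longrightarrow> G K s = f s"
    using ext unfolding U_def by metis
  have agree: "G K s = G L s" if "K \<le> L" "s \<in> U K" for K L s
  proof (rule analytic_continuation_open[of "U 0" "U K" "G K" "G L"])
    show "U 0 \<noteq> {}"
      by (auto simp: U_def intro!: exI[of _ "of_real (a + 1)"])
    show "U 0 \<subseteq> U K"
      by (auto simp: U_def)
    have "U K \<subseteq> U L"
      using that by (auto simp: U_def)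
    then show "G L holomorphic_on U K"
      using G(1) holomorphic_on_subset by blast
    show "G K z = G L z" if "z \<in> U 0" for z
      using that G(2) by (simp add: U_def)
  qed (use U G(1) that in auto)
  have cover: "\<exists>K. s \<in> U K" for s
  proof -
    obtain K where "a - Re s < real K"
      using reals_Archimedean2 by blast
    then show ?thesis
      by (intro exI[of _ K]) (auto simp: U_def)
  qed
  define E where "E = (\<lambda>s. G (LEAST K. s \<in> U K) s)"
  have E: "E s = G K s" if "s \<in> U K" for s K
    unfolding E_def using that by (intro agree Least_le LeastI[of "\<lambda>K. s \<in> U K"])
  have "E holomorphic_on U K" for K
    using G(1) by (rule holomorphic_transform) (simp add: E)
  then have "E holomorphic_on (\<Union>K. U K)"
    by (intro holomorphic_on_UN_open U)
  moreover have "(\<Union>K. U K) = UNIV"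
    using cover by auto
  moreover have "E s = f s" if "Re s > a" for s
    using E[of s 0] G(2)[OF that] that by (simp add: U_def)
  ultimately show ?thesis
    using that by metis
qed

abbreviation sawtooth :: "real \<Rightarrow> complex" where
  "sawtooth t \<equiv> 1 - complex_of_real t"

lemma sawtooth_continuous: "continuous_on A sawtooth"
  by (intro continuous_intros)

text \<open>
  The difference between the summand \<open>y powr -s\<close> and its integral over the cell, in a form that is
  visibly entire in \<open>s\<close> and one power of \<open>y\<close> smaller.
\<close>
lemma sawtooth_cell:
  assumes "x > 0" "s \<noteq> 1"
  shows "complex_of_real (real m + x) powr (- s) =
      (complex_of_real (real m + x) powr (1 - s) - complex_of_real (real m + 1 + x) powr (1 - s)) / (s - 1)
      + s * cell_integral sawtooth x m (s + 1)"
proof -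
  have "(sawtooth has_vector_derivative 0 - 1) (at t within {0..1})" for t
    by (auto intro!: derivative_eq_intros)
  from cell_integral_by_parts[OF \<open>x > 0\<close> continuous_on_const this \<open>s \<noteq> 1\<close>, of m]
  have "cell_integral (\<lambda>_. 0) x m s = - (complex_of_real (real m + x) powr (- s)) +
      (complex_of_real (real m + x) powr (1 - s) - complex_of_real (real m + 1 + x) powr (1 - s)) / (s - 1)
      + s * cell_integral sawtooth x m (s + 1)"
    by simp
  moreover have "cell_integral (\<lambda>_. 0) x m s = 0"
    by (simp add: cell_integral_def)
  ultimately show ?thesis
    by (simp add: algebra_simps)
qed

lemma hurwitz_series_sums:
  assumes "x > 0" "Re s > 1"
  shows "(\<lambda>m. 1 / complex_of_real (real m + x) powr s) sums
    (complex_of_real x powr (1 - s) / (s - 1) + s * periodic_mellin sawtooth x (s + 1))"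
proof -
  have "s \<noteq> 1"
    using assms by auto
  have "(\<lambda>m. (complex_of_real (real m + x) powr (1 - s)
              - complex_of_real (real m + 1 + x) powr (1 - s)) / (s - 1)
            + s * cell_integral sawtooth x m (s + 1))
        sums (complex_of_real x powr (1 - s) / (s - 1) + s * periodic_mellin sawtooth x (s + 1))"
    using assms by (intro sums_add sums_mult sums_divide telescoping_powr_sums cell_integral_sums
        sawtooth_continuous) auto
  moreover have "1 / complex_of_real (real m + x) powr s = complex_of_real (real m + x) powr (- s)" for m
    by (simp add: powr_minus_divide)
  ultimately show ?thesis
    unfolding sawtooth_cell[OF \<open>x > 0\<close> \<open>s \<noteq> 1\<close>, symmetric] by simp
qed

lemma connected_halfplane_minus_point: "connected ({s. Re s > a} - {z})"
  by (intro connected_open_delete open_halfspace_Re_gt convex_connected convex_halfspace_Re_gt) simp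

text \<open>
  This justifies the definite description of the Hurwitz zeta function. Only the sawtooth transform
  at \<open>s + 1\<close> has to be continued. Its continuation \<open>E\<close> already contains the factor
  \<open>(s + 1) - 1 = s\<close> that stands in front of it.
\<close>
lemma hurwitz_zeta_continuation_unique_exists:
  assumes "x > 0"
  shows "\<exists>!f. f holomorphic_on (- {1}) \<and> f 1 = 0 \<and>
     (\<forall>z. Re z > 1 \<longrightarrow> (\<lambda>m. 1 / complex_of_real (real m + x) powr z) sums f z)"
proof (rule ex_ex1I)
  obtain E where E: "E holomorphic_on UNIV"
    "\<And>s. Re s > 1 \<Longrightarrow> E s = (s - 1) * periodic_mellin sawtooth x s"
    using entire_continuation_from_halfplanes[of 1 "\<lambda>s. (s - 1) * periodic_mellin sawtooth x s"]
      periodic_mellin_continues_to_halfplane[OF \<open>x > 0\<close> sawtooth_continuous] by metis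
  define g where "g = (\<lambda>s. complex_of_real x powr (1 - s) / (s - 1) + E (s + 1))"
  define f where "f = (\<lambda>s. if s = 1 then 0 else g s)"
  have "(E \<circ> (\<lambda>s. s + 1)) holomorphic_on (- {1})"
    by (rule holomorphic_on_compose_gen[OF _ E(1)]) (auto intro!: holomorphic_intros)
  then have "g holomorphic_on (- {1})"
    unfolding g_def by (intro holomorphic_intros) (simp_all add: o_def)
  then have "f holomorphic_on (- {1})"
    by (rule holomorphic_transform) (simp add: f_def)
  moreover have "(\<lambda>m. 1 / complex_of_real (real m + x) powr z) sums f z" if "Re z > 1" for z
    using hurwitz_series_sums[OF assms that] E(2)[of "z + 1"] that by (auto simp: f_def g_def)
  ultimately show "\<exists>f. f holomorphic_on (- {1}) \<and> f 1 = 0 \<and>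
     (\<forall>z. Re z > 1 \<longrightarrow> (\<lambda>m. 1 / complex_of_real (real m + x) powr z) sums f z)"
    by (intro exI[of _ f]) (simp add: f_def)
next
  fix f g :: "complex \<Rightarrow> complex"
  assume f: "f holomorphic_on (- {1}) \<and> f 1 = 0 \<and>
      (\<forall>z. Re z > 1 \<longrightarrow> (\<lambda>m. 1 / complex_of_real (real m + x) powr z) sums f z)"
    and g: "g holomorphic_on (- {1}) \<and> g 1 = 0 \<and>
      (\<forall>z. Re z > 1 \<longrightarrow> (\<lambda>m. 1 / complex_of_real (real m + x) powr z) sums g z)"
  have "f z = g z" if "z \<noteq> 1" for z
  proof (rule analytic_continuation_open[of "{z. Re z > 1}" "- {1}" f g])
    show "{z. Re z > 1} \<noteq> {}"
      by (auto intro!: exI[of _ 2])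
    show "connected (- {1 :: complex})"
      by (intro connected_punctured_universe) simp
    show "f z = g z" if "z \<in> {z. Re z > 1}" for z
      using that f g sums_unique2 by blast
  qed (use f g that in \<open>auto simp: open_halfspace_Re_gt\<close>)
  then show "f = g"
    using f g by (intro ext) metis
qed

lemma
  assumes "x > 0"
  shows hurwitz_zeta_holomorphic: "(\<lambda>s. hurwitz_zeta s x) holomorphic_on (- {1})"
    and hurwitz_zeta_sums:
      "Re s > 1 \<Longrightarrow> (\<lambda>m. 1 / complex_of_real (real m + x) powr s) sums hurwitz_zeta s x"
  using theI'[OF hurwitz_zeta_continuation_unique_exists[OF assms]]
  unfolding hurwitz_zeta_def by simp_all

lemma hurwitz_zeta_eq_sawtooth:
  assumes "x > 0" "Re s > 0" "s \<noteq> 1"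
  shows "hurwitz_zeta s x =
    complex_of_real x powr (1 - s) / (s - 1) + s * periodic_mellin sawtooth x (s + 1)"
proof (rule analytic_continuation_open[of "{s. Re s > 1}" "{s. Re s > 0} - {1}"
      "\<lambda>s. hurwitz_zeta s x"
      "\<lambda>s. complex_of_real x powr (1 - s) / (s - 1) + s * periodic_mellin sawtooth x (s + 1)"])
  show "open ({s. Re s > 0} - {1})"
    by (intro open_Diff open_halfspace_Re_gt) simp
  show "{s. Re s > 1} \<noteq> {}"
    by (auto intro!: exI[of _ 2])
  show "connected ({s. Re s > 0} - {1})"
    by (rule connected_halfplane_minus_point)
  show "(\<lambda>s. hurwitz_zeta s x) holomorphic_on {s. Re s > 0} - {1}"
    using hurwitz_zeta_holomorphic[OF \<open>x > 0\<close>] by (rule holomorphic_on_subset) auto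
  have "(periodic_mellin sawtooth x \<circ> (\<lambda>s. s + 1)) holomorphic_on {s. Re s > 0} - {1}"
    by (rule holomorphic_on_compose_gen[OF _
          periodic_mellin_holomorphic[OF \<open>x > 0\<close> sawtooth_continuous]])
      (auto intro!: holomorphic_intros)
  then show "(\<lambda>s. complex_of_real x powr (1 - s) / (s - 1)
      + s * periodic_mellin sawtooth x (s + 1)) holomorphic_on {s. Re s > 0} - {1}"
    by (intro holomorphic_intros) (auto simp: o_def)
  show "hurwitz_zeta s x = complex_of_real x powr (1 - s) / (s - 1)
      + s * periodic_mellin sawtooth x (s + 1)" if "s \<in> {s. Re s > 1}" for s
    using hurwitz_zeta_sums[OF \<open>x > 0\<close>] hurwitz_series_sums[OF \<open>x > 0\<close>] that sums_unique2 by blast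
qed (use assms in \<open>auto simp: open_halfspace_Re_gt\<close>)

section \<open>Power series on a punctured neighbourhood\<close>

text \<open>
  The value at the centre is not prescribed, but the difference of the two series tends to its
  constant coefficient there, so this coefficient vanishes, and zeros of a non-trivial power series
  are isolated.
\<close>
lemma power_series_coeffs_unique_at:
  fixes a b :: "nat \<Rightarrow> complex"
  assumes a: "\<forall>\<^sub>F s in at z. (\<lambda>k. a k * (s - z) ^ k) sums f s"
    and b: "\<forall>\<^sub>F s in at z. (\<lambda>k. b k * (s - z) ^ k) sums f s"
  shows "a = b"
proof (rule ccontr)
  assume "a \<noteq> b"
  define d where "d = (\<lambda>k. a k - b k)"
  have "\<forall>\<^sub>F s in at z. (\<lambda>k. d k * (s - z) ^ k) sums 0"
    using a b
  proof eventually_elim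
    case (elim s)
    from sums_diff[OF this] show ?case
      by (simp add: d_def algebra_simps)
  qed
  then obtain r where r: "r > 0" "\<And>s. s \<noteq> z \<Longrightarrow> dist s z < r \<Longrightarrow> (\<lambda>k. d k * (s - z) ^ k) sums 0"
    unfolding eventually_at by blast
  have d: "(\<lambda>k. d k * w ^ k) sums 0" if "w \<noteq> 0" "norm w < r" for w
    using r(2)[of "w + z"] that by (simp add: dist_norm)
  have "((\<lambda>_. 0) \<longlongrightarrow> d 0) (at (0 :: complex))"
    by (rule powser_limit_0_strong[where f = "\<lambda>_. 0", OF r(1)]) (rule d)
  then have d0: "d 0 = 0"
    by (simp add: tendsto_const_iff)
  obtain m where m: "d m \<noteq> 0"
    using \<open>a \<noteq> b\<close> by (auto simp: d_def fun_eq_iff)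
  with d0 have "m > 0"
    by (cases m) auto
  have sums: "(\<lambda>k. d k * (w - 0) ^ k) sums 0" if "norm (w - 0) < r" for w
    using d[of w] that sums_0[of "\<lambda>k. d k * w ^ k"] d0
    by (cases "w = 0") (auto simp: power_0_left)
  obtain e where "e > 0" "\<And>w. w \<in> cball 0 e - {0 :: complex} \<Longrightarrow> (0 :: complex) \<noteq> 0"
    using powser_0_nonzero[OF r(1), of 0 d "\<lambda>_. 0" m] sums m \<open>m > 0\<close> by metis
  moreover from \<open>e > 0\<close> have "complex_of_real e \<in> cball 0 e - {0}"
    by simp
  ultimately show False
    by metis
qed

text \<open>
  The normalisation of the Stieltjes constants. Phrasing it as a relation for arbitrary functions lets
  the constants of a sum be computed summand by summand.
\<close>
definition stieltjes_expansion :: "(complex \<Rightarrow> complex) \<Rightarrow> (nat \<Rightarrow> complex) \<Rightarrow> bool" where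
  "stieltjes_expansion f c \<longleftrightarrow>
     (\<forall>\<^sub>F s in at 1. (\<lambda>k. (-1) ^ k / fact k * c k * (s - 1) ^ k) sums f s)"

lemma stieltjes_expansion_unique:
  assumes "stieltjes_expansion f c" "stieltjes_expansion f d"
  shows "c = d"
proof -
  have "(\<lambda>k. (-1) ^ k / fact k * c k) = (\<lambda>k. (-1) ^ k / fact k * d k)"
    using assms unfolding stieltjes_expansion_def by (rule power_series_coeffs_unique_at)
  then show ?thesis
    by (simp add: fun_eq_iff)
qed

lemma stieltjes_expansion_cong:
  assumes "stieltjes_expansion f c" "\<forall>\<^sub>F s in at 1. f s = g s"
  shows "stieltjes_expansion g c"
  using assms unfolding stieltjes_expansion_def by eventually_elim simp

lemma stieltjes_expansion_add:
  assumes "stieltjes_expansion f c" "stieltjes_expansion g d"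
  shows "stieltjes_expansion (\<lambda>s. f s + g s) (\<lambda>k. c k + d k)"
  using assms unfolding stieltjes_expansion_def
proof eventually_elim
  case (elim s)
  from sums_add[OF this] show ?case
    by (simp add: distrib_left distrib_right)
qed

lemma stieltjes_expansion_diff:
  assumes "stieltjes_expansion f c" "stieltjes_expansion g d"
  shows "stieltjes_expansion (\<lambda>s. f s - g s) (\<lambda>k. c k - d k)"
  using assms unfolding stieltjes_expansion_def
proof eventually_elim
  case (elim s)
  from sums_diff[OF this] show ?case
    by (simp add: left_diff_distrib right_diff_distrib)
qed

lemma stieltjes_expansion_holomorphic:
  assumes "f holomorphic_on ball 1 r" "r > 0"
  shows "stieltjes_expansion f (\<lambda>k. (-1) ^ k * (deriv ^^ k) f 1)"
  unfolding stieltjes_expansion_def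
proof (rule eventually_mono[OF eventually_at_in_open'[of "ball 1 r"]])
  fix s :: complex assume "s \<in> ball 1 r"
  from holomorphic_power_series[OF assms(1) this]
  show "(\<lambda>k. (-1) ^ k / fact k * ((-1) ^ k * (deriv ^^ k) f 1) * (s - 1) ^ k) sums f s"
    by (simp add: power_mult_distrib[symmetric] mult.assoc[symmetric])
qed (use assms in auto)

lemma stieltjes_expansion_powr:
  assumes "y > 0"
  shows "stieltjes_expansion (\<lambda>s. complex_of_real y powr (- s)) (\<lambda>k. complex_of_real (ln y ^ k / y))"
  unfolding stieltjes_expansion_def
proof (rule always_eventually, rule allI)
  fix s :: complex
  have y: "complex_of_real y powr (- s) = exp (- (s - 1) * ln y) / y"
  proof -
    have "complex_of_real y powr (- s) = exp (- (s - 1) * ln y - of_real (ln y))"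
      using assms by (simp add: powr_def Ln_of_real algebra_simps)
    also have "\<dots> = exp (- (s - 1) * ln y) / y"
      using assms by (simp add: exp_diff exp_of_real)
    finally show ?thesis .
  qed
  have "(\<lambda>k. (- (s - 1) * ln y) ^ k /\<^sub>R fact k / y) sums (exp (- (s - 1) * ln y) / y)"
    by (intro sums_divide exp_converges)
  moreover have "(- (s - 1) * ln y) ^ k /\<^sub>R fact k / y
      = (-1) ^ k / fact k * complex_of_real (ln y ^ k / y) * (s - 1) ^ k" for k
  proof -
    have "(- (s - 1) * ln y) ^ k = (-1) ^ k * ((s - 1) ^ k * of_real (ln y ^ k))"
      by (simp only: minus_mult_left[symmetric] power_minus[of "(s - 1) * _"] power_mult_distrib
          of_real_power)
    then show ?thesis
      by (simp add: scaleR_conv_of_real field_simps)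
  qed
  ultimately show "(\<lambda>k. (-1) ^ k / fact k * complex_of_real (ln y ^ k / y) * (s - 1) ^ k)
      sums (complex_of_real y powr (- s))"
    by (simp only: y)
qed

text \<open>
  The quotient by \<open>s - 1\<close> shifts the exponential series by one index; this is the source of the power
  \<open>ln y ^ (k + 1)\<close> and of the denominator \<open>k + 1\<close>.
\<close>
lemma stieltjes_expansion_powr_quotient:
  assumes "y > 0"
  shows "stieltjes_expansion (\<lambda>s. (complex_of_real y powr (1 - s) - 1) / (s - 1))
    (\<lambda>k. complex_of_real (- (ln y ^ (k + 1) / real (k + 1))))"
  unfolding stieltjes_expansion_def
proof (rule eventually_at_topological[THEN iffD2], intro exI[of _ UNIV] conjI ballI impI)
  fix s :: complex assume "s \<noteq> 1"
  have y: "complex_of_real y powr (1 - s) = exp (- (s - 1) * ln y)"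
    using assms by (simp add: powr_def Ln_of_real algebra_simps)
  have "(\<lambda>k. (- (s - 1) * ln y) ^ k /\<^sub>R fact k) sums exp (- (s - 1) * ln y)"
    by (rule exp_converges)
  then have "(\<lambda>k. (- (s - 1) * ln y) ^ Suc k /\<^sub>R fact (Suc k)) sums (exp (- (s - 1) * ln y) - 1)"
    by (subst sums_Suc_iff) simp
  then have "(\<lambda>k. (- (s - 1) * ln y) ^ Suc k /\<^sub>R fact (Suc k) / (s - 1)) sums
      ((exp (- (s - 1) * ln y) - 1) / (s - 1))"
    by (rule sums_divide)
  moreover have "(- (s - 1) * ln y) ^ Suc k /\<^sub>R fact (Suc k) / (s - 1)
      = (-1) ^ k / fact k * complex_of_real (- (ln y ^ (k + 1) / real (k + 1))) * (s - 1) ^ k" for k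
  proof -
    have "(- (s - 1) * ln y) ^ Suc k = (-1) ^ Suc k * ((s - 1) ^ Suc k * of_real (ln y ^ Suc k))"
      by (simp only: minus_mult_left[symmetric] power_minus[of "(s - 1) * _"] power_mult_distrib
          of_real_power)
    then show ?thesis
      using \<open>s \<noteq> 1\<close>
      by (simp add: scaleR_conv_of_real divide_simps del: of_nat_Suc)
  qed
  ultimately show "(\<lambda>k. (-1) ^ k / fact k * complex_of_real (- (ln y ^ (k + 1) / real (k + 1)))
      * (s - 1) ^ k) sums ((complex_of_real y powr (1 - s) - 1) / (s - 1))"
    by (simp only: y)
qed auto

section \<open>The Stieltjes constants\<close>

abbreviation (input) stieltjes_term :: "nat \<Rightarrow> real \<Rightarrow> nat \<Rightarrow> real" where
  "stieltjes_term n x k \<equiv> ln (real k + x) ^ n / (real k + x)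
        - 1 / real (n + 1) * (ln (real k + 1 + x) ^ (n + 1) - ln (real k + x) ^ (n + 1))"

lemma shifted_cell_holomorphic:
  assumes "x > 0"
  shows "(\<lambda>s. s * cell_integral sawtooth x m (s + 1)) holomorphic_on A"
proof -
  have "(cell_integral sawtooth x m \<circ> (\<lambda>s. s + 1)) holomorphic_on A"
    by (intro holomorphic_on_compose holomorphic_intros cell_integral_holomorphic assms
        sawtooth_continuous)
  then show ?thesis
    by (intro holomorphic_intros) (simp add: o_def)
qed

text \<open>
  Away from \<open>s = 1\<close> the function is an explicit combination of exponentials whose expansion is known.
  Being entire, it also has its Taylor expansion at \<open>1\<close>, and the two must agree. Subtracting \<open>1\<close>
  from both \<open>(m + x) powr (1 - s)\<close> and \<open>(m + 1 + x) powr (1 - s)\<close> makes each quotient by \<open>s - 1\<close>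
  regular on its own.
\<close>
lemma higher_deriv_shifted_cell:
  assumes "x > 0"
  shows "(-1) ^ n * (deriv ^^ n) (\<lambda>s. s * cell_integral sawtooth x m (s + 1)) 1
    = complex_of_real (stieltjes_term n x m)"
proof -
  have pos: "real m + x > 0" "real m + 1 + x > 0"
    using assms by auto
  let ?h = "\<lambda>s. s * cell_integral sawtooth x m (s + 1)"
  have "stieltjes_expansion (\<lambda>s. complex_of_real (real m + x) powr (- s)
      - ((complex_of_real (real m + x) powr (1 - s) - 1) / (s - 1)
         - (complex_of_real (real m + 1 + x) powr (1 - s) - 1) / (s - 1)))
    (\<lambda>k. complex_of_real (ln (real m + x) ^ k / (real m + x))
      - (complex_of_real (- (ln (real m + x) ^ (k + 1) / real (k + 1)))
         - complex_of_real (- (ln (real m + 1 + x) ^ (k + 1) / real (k + 1)))))"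
    (is "stieltjes_expansion ?g ?c")
    by (intro stieltjes_expansion_diff stieltjes_expansion_powr stieltjes_expansion_powr_quotient pos)
  moreover have "\<forall>\<^sub>F s in at 1. ?g s = ?h s"
    unfolding eventually_at_filter
  proof (rule always_eventually, intro allI impI)
    fix s :: complex assume "s \<noteq> 1"
    show "?g s = ?h s"
      using sawtooth_cell[OF assms \<open>s \<noteq> 1\<close>, of m] unfolding diff_divide_distrib[symmetric] by simp
  qed
  ultimately have "stieltjes_expansion ?h ?c"
    by (rule stieltjes_expansion_cong)
  moreover have "stieltjes_expansion ?h (\<lambda>k. (-1) ^ k * (deriv ^^ k) ?h 1)"
    by (rule stieltjes_expansion_holomorphic[OF shifted_cell_holomorphic[OF assms], of 1]) simp
  ultimately have "(\<lambda>k. (-1) ^ k * (deriv ^^ k) ?h 1) = ?c"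
    by (rule stieltjes_expansion_unique[rotated])
  from fun_cong[OF this, of n] show ?thesis
    unfolding of_real_diff[symmetric]
    by (simp only: of_real_eq_iff) (simp add: diff_divide_distrib)
qed

lemma higher_deriv_sum:
  assumes "finite I" "\<And>i. i \<in> I \<Longrightarrow> f i holomorphic_on S" "open S" "z \<in> S"
  shows "(deriv ^^ n) (\<lambda>w. \<Sum>i\<in>I. f i w) z = (\<Sum>i\<in>I. (deriv ^^ n) (f i) z)"
  using assms(1,2)
proof (induction I rule: finite_induct)
  case (insert i I)
  have "(deriv ^^ n) (\<lambda>w. f i w + (\<Sum>i\<in>I. f i w)) z
      = (deriv ^^ n) (f i) z + (deriv ^^ n) (\<lambda>w. \<Sum>i\<in>I. f i w) z"
    using insert.prems assms(3,4) by (intro higher_deriv_add holomorphic_on_sum) auto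
  then show ?case
    using insert by simp
qed simp

text \<open>
  Weierstrass' theorem on the derivatives of a uniform limit, on a disc of radius \<open>1 / 2\<close> so that
  the transform is evaluated at arguments \<open>s + 1\<close> of real part at least \<open>3 / 2\<close>, where the
  cell integrals are dominated uniformly.
\<close>
lemma stieltjes_term_sums:
  assumes "x > 0"
  shows "(\<lambda>m. complex_of_real (stieltjes_term n x m)) sums
    ((-1) ^ n * (deriv ^^ n) (\<lambda>s. s * periodic_mellin sawtooth x (s + 1)) 1)"
proof -
  let ?h = "\<lambda>m s. s * cell_integral sawtooth x m (s + 1)"
  let ?H = "\<lambda>s. s * periodic_mellin sawtooth x (s + 1)"
  let ?B = "ball (1 :: complex) (1 / 2)"
  have B: "Re s > 1 / 2" "norm s \<le> 2" if "s \<in> ?B" for s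
  proof -
    show "Re s > 1 / 2"
      using that complex_Re_le_cmod[of "1 - s"] by (simp add: dist_norm)
    show "norm s \<le> 2"
      using that norm_triangle_sub[of s 1] by (simp add: dist_norm norm_minus_commute)
  qed
  have cells: "uniform_limit ?B (\<lambda>N s. \<Sum>m<N. cell_integral sawtooth x m (s + 1))
      (\<lambda>s. periodic_mellin sawtooth x (s + 1)) sequentially"
    by (rule uniform_limit_compose'[OF
          periodic_mellin_uniform_limit[OF assms sawtooth_continuous, of "3 / 2"]])
      (use B in fastforce)+
  have lim: "uniform_limit ?B (\<lambda>N s. \<Sum>m<N. ?h m s) ?H sequentially"
  proof (rule uniform_limitI)
    fix e :: real assume "e > 0"
    then have "\<forall>\<^sub>F N in sequentially. \<forall>s\<in>?B.
        dist (\<Sum>m<N. cell_integral sawtooth x m (s + 1)) (periodic_mellin sawtooth x (s + 1)) < e / 2"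
      using cells by (intro uniform_limitD) auto
    then show "\<forall>\<^sub>F N in sequentially. \<forall>s\<in>?B. dist (\<Sum>m<N. ?h m s) (?H s) < e"
    proof (eventually_elim, intro ballI)
      fix N s assume le: "\<forall>s\<in>?B. dist (\<Sum>m<N. cell_integral sawtooth x m (s + 1))
        (periodic_mellin sawtooth x (s + 1)) < e / 2" and s: "s \<in> ?B"
      have "dist (\<Sum>m<N. ?h m s) (?H s) = norm s * dist (\<Sum>m<N. cell_integral sawtooth x m (s + 1))
        (periodic_mellin sawtooth x (s + 1))"
        unfolding dist_norm sum_distrib_left[symmetric] right_diff_distrib[symmetric] norm_mult ..
      also have "\<dots> \<le> 2 * dist (\<Sum>m<N. cell_integral sawtooth x m (s + 1))
        (periodic_mellin sawtooth x (s + 1))"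
        using B(2)[OF s] by (intro mult_right_mono) auto
      also have "\<dots> < e"
        using le s by fastforce
      finally show "dist (\<Sum>m<N. ?h m s) (?H s) < e" .
    qed
  qed
  have "(\<lambda>N. (deriv ^^ n) (\<lambda>s. \<Sum>m<N. ?h m s) 1) \<longlonglongrightarrow> (deriv ^^ n) ?H 1"
    by (rule higher_deriv_complex_uniform_limit[OF lim])
      (auto intro!: always_eventually holomorphic_on_sum shifted_cell_holomorphic assms)
  moreover have "(deriv ^^ n) (\<lambda>s. \<Sum>m<N. ?h m s) 1 = (\<Sum>m<N. (deriv ^^ n) (?h m) 1)" for N
    by (rule higher_deriv_sum[of _ _ UNIV]) (auto intro: shifted_cell_holomorphic assms)
  ultimately have "(\<lambda>m. (deriv ^^ n) (?h m) 1) sums (deriv ^^ n) ?H 1"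
    by (simp add: sums_def)
  from sums_mult[OF this, of "(-1) ^ n"] show ?thesis
    unfolding higher_deriv_shifted_cell[OF assms] .
qed

text \<open>
  The pole \<open>1 / (s - 1)\<close> is absorbed by \<open>x powr (1 - s) / (s - 1)\<close>, which leaves a regular quotient
  and the analytic sawtooth part.
\<close>
lemma gen_stieltjes_eq:
  assumes "x > 0"
  shows "gen_stieltjes n x = complex_of_real (- (ln x ^ (n + 1) / real (n + 1)))
    + (-1) ^ n * (deriv ^^ n) (\<lambda>s. s * periodic_mellin sawtooth x (s + 1)) 1"
proof -
  let ?H = "\<lambda>s. s * periodic_mellin sawtooth x (s + 1)"
  have B: "Re s > 0" if "s \<in> ball 1 1" for s
    using that complex_Re_le_cmod[of "1 - s"] by (simp add: dist_norm)
  have "(periodic_mellin sawtooth x \<circ> (\<lambda>s. s + 1)) holomorphic_on ball 1 1"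
    by (rule holomorphic_on_compose_gen[OF _
          periodic_mellin_holomorphic[OF assms sawtooth_continuous]])
      (use B in \<open>auto intro!: holomorphic_intros\<close>)
  then have H: "?H holomorphic_on ball 1 1"
    by (intro holomorphic_intros) (simp add: o_def)
  let ?c = "\<lambda>k. complex_of_real (- (ln x ^ (k + 1) / real (k + 1))) + (-1) ^ k * (deriv ^^ k) ?H 1"
  have "stieltjes_expansion (\<lambda>s. (complex_of_real x powr (1 - s) - 1) / (s - 1) + ?H s) ?c"
    by (intro stieltjes_expansion_add stieltjes_expansion_powr_quotient assms
        stieltjes_expansion_holomorphic[OF H]) simp
  moreover have "\<forall>\<^sub>F s in at 1. (complex_of_real x powr (1 - s) - 1) / (s - 1) + ?H s
      = hurwitz_zeta s x - 1 / (s - 1)"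
    using eventually_at_in_open[of "ball 1 1" 1]
  proof (rule eventually_mono)
    fix s :: complex assume "s \<in> ball 1 1 - {1}"
    then show "(complex_of_real x powr (1 - s) - 1) / (s - 1) + ?H s = hurwitz_zeta s x - 1 / (s - 1)"
      using hurwitz_zeta_eq_sawtooth[OF assms B, of s] by (simp add: diff_divide_distrib)
  qed auto
  ultimately have c: "stieltjes_expansion (\<lambda>s. hurwitz_zeta s x - 1 / (s - 1)) ?c"
    by (rule stieltjes_expansion_cong)
  have "(THE c. stieltjes_expansion (\<lambda>s. hurwitz_zeta s x - 1 / (s - 1)) c) = ?c"
    by (rule the_equality[of "stieltjes_expansion (\<lambda>s. hurwitz_zeta s x - 1 / (s - 1))", OF c])
      (rule stieltjes_expansion_unique[OF _ c])
  then show ?thesis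
    unfolding gen_stieltjes_def stieltjes_expansion_def by simp
qed

theorem proposition3p1:
  fixes n :: nat
  shows "(\<forall>x::real. x > 0 \<longrightarrow>
      summable (\<lambda>k::nat. ln (real k + x) ^ n / (real k + x)
        - 1 / real (n + 1) * (ln (real k + 1 + x) ^ (n + 1) - ln (real k + x) ^ (n + 1))) \<and>
      gen_stieltjes n x = complex_of_real (- (ln x ^ (n + 1) / real (n + 1))
        + (\<Sum>k::nat. ln (real k + x) ^ n / (real k + x)
        - 1 / real (n + 1) * (ln (real k + 1 + x) ^ (n + 1) - ln (real k + x) ^ (n + 1))))) \<and>
    (\<lambda>N::nat. complex_of_real (\<Sum>k=1..N. ln (real k) ^ n / real k
        - 1 / real (n + 1) * (ln (real k + 1) ^ (n + 1) - ln (real k) ^ (n + 1))))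
      \<longlonglongrightarrow> stieltjes n"
proof (intro conjI allI impI)
  fix x :: real assume x: "x > 0"
  note sums = stieltjes_term_sums[OF x, of n]
  show summable: "summable (stieltjes_term n x)"
    using sums_summable[OF sums] by (simp only: summable_of_real_iff)
  have "(\<lambda>m. complex_of_real (stieltjes_term n x m)) sums complex_of_real (suminf (stieltjes_term n x))"
    using summable by (intro sums_of_real summable_sums)
  from sums_unique2[OF this sums]
  show "gen_stieltjes n x = complex_of_real (- (ln x ^ (n + 1) / real (n + 1))
      + suminf (stieltjes_term n x))"
    unfolding gen_stieltjes_eq[OF x] by (simp only: of_real_add)
next
  have "stieltjes n = (-1) ^ n * (deriv ^^ n) (\<lambda>s. s * periodic_mellin sawtooth 1 (s + 1)) 1"
    unfolding stieltjes_def gen_stieltjes_eq[OF zero_less_one] by simp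
  then have "(\<lambda>N. \<Sum>m<N. complex_of_real (stieltjes_term n 1 m)) \<longlonglongrightarrow> stieltjes n"
    using stieltjes_term_sums[OF zero_less_one, of n] unfolding sums_def by simp
  moreover have "(\<Sum>m<N. complex_of_real (stieltjes_term n 1 m)) =
      complex_of_real (\<Sum>k=1..N. ln (real k) ^ n / real k
        - 1 / real (n + 1) * (ln (real k + 1) ^ (n + 1) - ln (real k) ^ (n + 1)))" for N
    unfolding of_real_sum[symmetric]
    by (intro arg_cong[of _ _ complex_of_real] sum.reindex_bij_witness[of _ "\<lambda>k. k - 1" Suc])
      (auto simp: algebra_simps)
  ultimately show "(\<lambda>N::nat. complex_of_real (\<Sum>k=1..N. ln (real k) ^ n / real k
        - 1 / real (n + 1) * (ln (real k + 1) ^ (n + 1) - ln (real k) ^ (n + 1))))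
      \<longlonglongrightarrow> stieltjes n"
    by simp
qed

end
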